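(* Fix the value of $|\lambda^e|>0$ and let $\rho$ be a real solution of $$m_0(m_1+m_2)\big((1+\rho)m_2+\rho m_1\big)h_1(\rho)=m_1m_2(m_0+m_1+m_2)h_2(\rho),$$ where $$h_1(\rho)=\frac{Gm_1m_2}{|\lambda^e|^3}+\frac{Gm_0m_1\,\mathrm{sgn}(1+\rho)}{M_2|\lambda^e|^3}\Big(\frac{m_2}{(1+\rho)^2}+\frac{\beta_2}{(1+\rho)^4|\lambda^e|^2}\Big)-\frac{Gm_0m_2\,\mathrm{sgn}(\rho)}{M_2|\lambda^e|^3}\Big(\frac{m_1}{\rho^2}+\frac{\beta_1}{\rho^4|\lambda^e|^2}\Big),$$ $$h_2(\rho)=\frac{Gm_0\,\mathrm{sgn}(1+\rho)}{|\lambda^e|^3}\Big(\frac{m_2}{(1+\rho)^2}+\frac{\beta_2}{|\lambda^e|^2(1+\rho)^4}\Big)+\frac{Gm_0\,\mathrm{sgn}(\rho)}{|\lambda^e|^3}\Big(\frac{m_1}{\rho^2}+\frac{\beta_1}{|\lambda^e|^2\rho^4}\Big).$$ Then $\mathbf z_e=(\Pi_2^e,\Pi_1^e,\Pi_0^e,\lambda^e,p_\lambda^e,\mu^e,p_\mu^e)$ given by $$\lambda^e=(\lambda^e,0,0),\quad \mu^e=(\mu^e,0,0),\quad \Omega_0^e=(0,0,\omega_0^e),$$ $$p_\lambda^e=(0,g_1\omega_0^e\lambda^e,0),\quad p_\mu^e=(0,g_2\omega_0^e\mu^e,0),\quad \Pi_0^e=(0,0,C_0\omega_0^e+l),$$ where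 (with the same letters for the vectors and their first components) $$\mu^e=\frac{(1+\rho)m_2+\rho m_1}{M_2}\lambda^e,\qquad \omega_0^e\in\mathbb R,\quad(\omega_0^e)^2=\frac{(m_1+m_2)h_1(\rho)}{m_1m_2},$$ and where $\Pi_1^e,\Pi_2^e$ verify $\Pi_1^e\times\Omega_1^e=0$, $\Pi_2^e\times\Omega_2^e=0$, is an Eulerian relative equilibrium. The total angular momentum $\mathbf L=\Pi_2+\Pi_1+\Pi_0+\lambda\times p_\lambda+\mu\times p_\mu$ of the system at $\mathbf z_e$ (with $\Omega_i^e=(0,0,\omega_i^e)$, $i=1,2$) is $$\mathbf L=\big(0,0,\;C_2\omega_2^e+C_1\omega_1^e+C_0\omega_0^e+l+g_1\omega_0^e(\lambda^e)^2+g_2\omega_0^e(\mu^e)^2\big).$$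
   Context: Setting. $G>0$; $m_0,m_1,m_2>0$ are the masses of a gyrostat $S_0$ and two symmetric rigid bodies $S_1,S_2$. Put $M_2=m_1+m_2$, $M_1=m_0+m_1+m_2$, $g_1=m_1m_2/M_2$, $g_2=m_0M_2/M_1$. Inertia tensors: $\mathbb I_i=\mathrm{diag}(A_i,A_i,C_i)$, $A_i,C_i>0$, $i=0,1,2$; $\beta_i=\frac32(C_i-A_i)$ for $i=1,2$. $\mathrm{sgn}(x)=1$ if $x>0$ and $-1$ if $x\le0$. The gyrostatic momentum is the constant vector $l_r=(0,0,l)$. The state is $\mathbf z=(\Pi_1,\Pi_2,\Pi_0,\lambda,p_\lambda,\mu,p_\mu)\in\mathbb R^{21}$ (seven vectors of $\mathbb R^3$), with $\Pi_0=\mathbb I_0\Omega_0+l_r$ and $\Pi_i=\mathbb I_i\Omega_i$ ($i=1,2$). Put $x_1=\mu-\frac{m_2}{M_2}\lambda$, $x_2=\mu+\frac{m_1}{M_2}\lambda$. The potential is $\mathcal V=\mathcal V_1+\mathcal V_2$ (defined for $\lambda,x_1,x_2\ne0$), where $$\mathcal V_1=-\Big(\frac{Gm_1m_2}{|\lambda|}+\frac{Gm_1m_0}{|x_1|}+\frac{Gm_2m_0}{|x_2|}\Big),\qquad \mathcal V_2=-\frac12\sum_{i=1}^2\Big(\frac{Gm_0(2A_i+C_i)}{|x_i|^3}-\frac{3Gm_0\,x_i\cdot\mathbb I_ix_i}{|x_i|^5}\Big).$$ A relative equilibrium $\mathbf z_e$ is a state satisfying $$\Pi_0^e\times\Omega_0^e+\lambda^e\times(\nabla_\lambda\mathcal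 V)_e+\mu^e\times(\nabla_\mu\mathcal V)_e=0,$$ $$\frac{p_\lambda^e}{g_1}+\lambda^e\times\Omega_0^e=0,\quad p_\lambda^e\times\Omega_0^e=(\nabla_\lambda\mathcal V)_e,\quad \frac{p_\mu^e}{g_2}+\mu^e\times\Omega_0^e=0,\quad p_\mu^e\times\Omega_0^e=(\nabla_\mu\mathcal V)_e,$$ $$\Pi_1^e\times\Omega_1^e=0,\quad \Pi_2^e\times\Omega_2^e=0.$$ It is Eulerian if $\lambda^e$ and $\mu^e$ are proportional and $\Omega_0^e$ is perpendicular to the straight line they generate. *)

theory Defs
  imports "HOL-Analysis.Analysis"
begin

unbundle cross3_syntax

abbreviation vec3 :: "real \<Rightarrow> real \<Rightarrow> real \<Rightarrow> real^3"
  where "vec3 a b c \<equiv> vector [a, b, c]"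

text \<open>The gyrostat has index 0, the two symmetric rigid bodies have indices 1 and 2;
  values of the indexed fields at other indices are never used.\<close>

record gyro_params =
  grav :: real
  mass :: "nat \<Rightarrow> real"
  inA :: "nat \<Rightarrow> real"
  inC :: "nat \<Rightarrow> real"
  gyro_l :: real

record gyro_state =
  Pi1 :: "real^3"
  Pi2 :: "real^3"
  Pi0 :: "real^3"
  lam :: "real^3"
  plam :: "real^3"
  mu :: "real^3"
  pmu :: "real^3"

definition admissible :: "gyro_params \<Rightarrow> bool" where
  "admissible P \<longleftrightarrow> grav P > 0 \<and> (\<forall>i\<in>{0,1,2}. mass P i > 0 \<and> inA P i > 0 \<and> inC P i > 0)"

definition M2 :: "gyro_params \<Rightarrow> real" where
  "M2 P = mass P 1 + mass P 2"

definition M1 :: "gyro_params \<Rightarrow> real" where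
  "M1 P = mass P 0 + mass P 1 + mass P 2"

definition g1 :: "gyro_params \<Rightarrow> real" where
  "g1 P = mass P 1 * mass P 2 / M2 P"

definition g2 :: "gyro_params \<Rightarrow> real" where
  "g2 P = mass P 0 * M2 P / M1 P"

definition beta :: "gyro_params \<Rightarrow> nat \<Rightarrow> real" where
  "beta P i = 3 / 2 * (inC P i - inA P i)"

definition inertia :: "gyro_params \<Rightarrow> nat \<Rightarrow> real^3^3" where
  "inertia P i = vector [vec3 (inA P i) 0 0, vec3 0 (inA P i) 0, vec3 0 0 (inC P i)]"

text \<open>Unlike the library function \<open>sgn\<close>, the value at 0 is -1.\<close>

definition sgn_pm :: "real \<Rightarrow> real" where
  "sgn_pm x = (if x > 0 then 1 else -1)"

text \<open>For admissible parameters the inertia tensors are invertible, so the angular velocities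
  are the unique solutions of \<open>\<Pi>\<^sub>0 = \<bbbI>\<^sub>0 \<Omega>\<^sub>0 + l\<^sub>r\<close> and \<open>\<Pi>\<^sub>i = \<bbbI>\<^sub>i \<Omega>\<^sub>i\<close> for \<open>i = 1, 2\<close>.\<close>

definition Omega0 :: "gyro_params \<Rightarrow> gyro_state \<Rightarrow> real^3" where
  "Omega0 P z = matrix_inv (inertia P 0) *v (Pi0 z - vec3 0 0 (gyro_l P))"

definition Omega1 :: "gyro_params \<Rightarrow> gyro_state \<Rightarrow> real^3" where
  "Omega1 P z = matrix_inv (inertia P 1) *v Pi1 z"

definition Omega2 :: "gyro_params \<Rightarrow> gyro_state \<Rightarrow> real^3" where
  "Omega2 P z = matrix_inv (inertia P 2) *v Pi2 z"

definition x1 :: "gyro_params \<Rightarrow> real^3 \<Rightarrow> real^3 \<Rightarrow> real^3" where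
  "x1 P l m = m - (mass P 2 / M2 P) *\<^sub>R l"

definition x2 :: "gyro_params \<Rightarrow> real^3 \<Rightarrow> real^3 \<Rightarrow> real^3" where
  "x2 P l m = m + (mass P 1 / M2 P) *\<^sub>R l"

definition V1 :: "gyro_params \<Rightarrow> real^3 \<Rightarrow> real^3 \<Rightarrow> real" where
  "V1 P l m =
     - (grav P * mass P 1 * mass P 2 / norm l
        + grav P * mass P 1 * mass P 0 / norm (x1 P l m)
        + grav P * mass P 2 * mass P 0 / norm (x2 P l m))"

definition V2_summand :: "gyro_params \<Rightarrow> nat \<Rightarrow> real^3 \<Rightarrow> real" where
  "V2_summand P i x =
     grav P * mass P 0 * (2 * inA P i + inC P i) / norm x ^ 3
     - 3 * grav P * mass P 0 * (x \<bullet> (inertia P i *v x)) / norm x ^ 5"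

definition V2 :: "gyro_params \<Rightarrow> real^3 \<Rightarrow> real^3 \<Rightarrow> real" where
  "V2 P l m = - (1 / 2) * (V2_summand P 1 (x1 P l m) + V2_summand P 2 (x2 P l m))"

definition V :: "gyro_params \<Rightarrow> real^3 \<Rightarrow> real^3 \<Rightarrow> real" where
  "V P l m = V1 P l m + V2 P l m"

text \<open>\<open>GDERIV f x :> D\<close> determines the gradient \<open>D\<close> uniquely, so \<open>Dlam\<close> and \<open>Dmu\<close> are the partial
  gradients of the potential. The first three conditions are the domain of the potential.\<close>

definition relative_equilibrium :: "gyro_params \<Rightarrow> gyro_state \<Rightarrow> bool" where
  "relative_equilibrium P z \<longleftrightarrow>
     lam z \<noteq> 0 \<and> x1 P (lam z) (mu z) \<noteq> 0 \<and> x2 P (lam z) (mu z) \<noteq> 0 \<and>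
     (\<exists>Dlam Dmu.
        (GDERIV (\<lambda>y. V P y (mu z)) (lam z) :> Dlam) \<and>
        (GDERIV (\<lambda>y. V P (lam z) y) (mu z) :> Dmu) \<and>
        (Pi0 z \<times> Omega0 P z) + (lam z \<times> Dlam) + (mu z \<times> Dmu) = 0 \<and>
        (1 / g1 P) *\<^sub>R plam z + (lam z \<times> Omega0 P z) = 0 \<and>
        plam z \<times> Omega0 P z = Dlam \<and>
        (1 / g2 P) *\<^sub>R pmu z + (mu z \<times> Omega0 P z) = 0 \<and>
        pmu z \<times> Omega0 P z = Dmu \<and>
        Pi1 z \<times> Omega1 P z = 0 \<and>
        Pi2 z \<times> Omega2 P z = 0)"

text \<open>Since \<open>\<lambda> \<noteq> 0\<close> at a relative equilibrium, \<open>\<lambda>\<close> and \<open>\<mu>\<close> are proportional iff \<open>\<mu>\<close> is a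
  multiple of \<open>\<lambda>\<close>; the value \<open>\<mu> = 0\<close> is allowed.\<close>

definition eulerian_relative_equilibrium :: "gyro_params \<Rightarrow> gyro_state \<Rightarrow> bool" where
  "eulerian_relative_equilibrium P z \<longleftrightarrow>
     relative_equilibrium P z \<and>
     (\<exists>c. mu z = c *\<^sub>R lam z) \<and>
     (\<forall>v\<in>span {lam z, mu z}. orthogonal (Omega0 P z) v)"

definition total_angular_momentum :: "gyro_state \<Rightarrow> real^3" where
  "total_angular_momentum z = Pi2 z + Pi1 z + Pi0 z + (lam z \<times> plam z) + (mu z \<times> pmu z)"

text \<open>In the next two definitions \<open>r\<close> stands for \<open>\<bar>\<lambda>\<bar>\<close>.\<close>

definition h1 :: "gyro_params \<Rightarrow> real \<Rightarrow> real \<Rightarrow> real" where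
  "h1 P r \<rho> =
     grav P * mass P 1 * mass P 2 / r ^ 3
     + grav P * mass P 0 * mass P 1 * sgn_pm (1 + \<rho>) / (M2 P * r ^ 3)
         * (mass P 2 / (1 + \<rho>)\<^sup>2 + beta P 2 / ((1 + \<rho>) ^ 4 * r\<^sup>2))
     - grav P * mass P 0 * mass P 2 * sgn_pm \<rho> / (M2 P * r ^ 3)
         * (mass P 1 / \<rho>\<^sup>2 + beta P 1 / (\<rho> ^ 4 * r\<^sup>2))"

definition h2 :: "gyro_params \<Rightarrow> real \<Rightarrow> real \<Rightarrow> real" where
  "h2 P r \<rho> =
     grav P * mass P 0 * sgn_pm (1 + \<rho>) / r ^ 3
         * (mass P 2 / (1 + \<rho>)\<^sup>2 + beta P 2 / (r\<^sup>2 * (1 + \<rho>) ^ 4))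
     + grav P * mass P 0 * sgn_pm \<rho> / r ^ 3
         * (mass P 1 / \<rho>\<^sup>2 + beta P 1 / (r\<^sup>2 * \<rho> ^ 4))"

end

theory Submission
  imports Defs
begin

text \<open>
  The potential splits into the Newtonian attraction between the two bodies, which depends on
  \<open>\<lambda>\<close> only, and one potential for each body \<open>S\<^sub>i\<close>, a function of the position \<open>x\<^sub>i\<close> of \<open>S\<^sub>i\<close> relative
  to the gyrostat. Everything in the configuration lies on the first coordinate axis, which is in
  the equatorial plane of both bodies. There the inertia tensor acts as multiplication by \<open>A\<^sub>i\<close>, so
  the quadrupole correction becomes central and the gradient of the potential of \<open>S\<^sub>i\<close> is
  \<open>G m\<^sub>0 (m\<^sub>i / |x\<^sub>i|\<^sup>3 + \<beta>\<^sub>i / |x\<^sub>i|\<^sup>5) x\<^sub>i\<close>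
  (\<open>GDERIV_body_potential_equatorial\<close>).

  The relation between \<open>\<mu>\<close> and \<open>\<rho>\<close> says exactly that \<open>x\<^sub>1 = \<rho> \<lambda>\<close> and \<open>x\<^sub>2 = (1 + \<rho>) \<lambda>\<close>. Since \<open>x\<^sub>i\<close> is
  an affine function of each of \<open>\<lambda>\<close> and \<open>\<mu>\<close>, the chain rule gives the partial gradients of the
  potential, and in terms of \<open>\<rho>\<close> they are \<open>h\<^sub>1(\<rho>) \<lambda>\<close> and \<open>h\<^sub>2(\<rho>) \<lambda>\<close> (\<open>GDERIV_potential_axis\<close>); the signs
  in \<open>h\<^sub>1\<close> and \<open>h\<^sub>2\<close> record on which side of the gyrostat each body lies.

  All torques in the first equilibrium equation vanish because the vectors involved are parallel,
  and the equations for the velocities hold by the choice of the momenta. What remains is the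
  balance of centrifugal and gravitational forces along the axis, \<open>g\<^sub>1 \<omega>\<^sub>0\<^sup>2 \<lambda> = h\<^sub>1 \<lambda>\<close> and
  \<open>g\<^sub>2 \<omega>\<^sub>0\<^sup>2 \<mu> = h\<^sub>2 \<lambda>\<close>. The first is the formula for \<open>\<omega>\<^sub>0\<^sup>2\<close>. Inserting that formula and the value of
  \<open>\<mu>\<close> into the second turns it into the equation assumed for \<open>\<rho>\<close>. All angular momenta point along
  the third axis when \<open>\<Omega>\<^sub>1\<close> and \<open>\<Omega>\<^sub>2\<close> do, so the total angular momentum is a sum of third components.
\<close>

section \<open>Gradients\<close>

lemma GDERIV_compose_affine:
  fixes f :: "'a::real_inner \<Rightarrow> real"
  assumes "GDERIV f (c *\<^sub>R x + b) :> D"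
  shows "GDERIV (\<lambda>y. f (c *\<^sub>R y + b)) x :> c *\<^sub>R D"
proof -
  have inner: "((\<lambda>y. c *\<^sub>R y + b) has_derivative (\<lambda>h. c *\<^sub>R h)) (at x)"
    by (auto intro!: derivative_eq_intros)
  have "((\<lambda>y. f (c *\<^sub>R y + b)) has_derivative (\<lambda>h. (c *\<^sub>R h) \<bullet> D)) (at x)"
    using has_derivative_compose[OF inner] assms unfolding gderiv_def by blast
  then show ?thesis
    by (simp add: gderiv_def)
qed

lemma GDERIV_inverse_norm_power:
  fixes x :: "'a::real_inner"
  assumes "x \<noteq> 0"
  shows "GDERIV (\<lambda>y. 1 / norm y ^ n) x :> - (of_nat n / norm x ^ (n + 2)) *\<^sub>R x"
proof (cases n)
  case 0
  then show ?thesis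
    by (simp add: GDERIV_const)
next
  \<comment> \<open>Writing \<open>n\<close> as a successor avoids the truncated exponent \<open>n - 1\<close> in the derivative of \<open>t ^ n\<close>.\<close>
  case (Suc k)
  have "((\<lambda>t. 1 / t ^ n) has_real_derivative - (of_nat n * norm x ^ k / (norm x ^ n * norm x ^ n))) (at (norm x))"
    using assms Suc DERIV_inverse_fun[OF DERIV_pow[of n "norm x"]]
    by (auto simp: inverse_eq_divide divide_simps)
  from GDERIV_DERIV_compose[OF GDERIV_norm[OF assms] this]
  have "GDERIV (\<lambda>y. 1 / norm y ^ n) x
          :> - (of_nat n * norm x ^ k / (norm x ^ n * norm x ^ n)) *\<^sub>R sgn x" .
  moreover have "- (of_nat n * norm x ^ k / (norm x ^ n * norm x ^ n)) *\<^sub>R sgn x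
                   = - (of_nat n / norm x ^ (n + 2)) *\<^sub>R x"
    using assms Suc by (simp add: sgn_div_norm field_simps)
  ultimately show ?thesis
    by simp
qed

lemma GDERIV_quadratic_form:
  fixes A :: "real^'n^'n"
  assumes "transpose A = A"
  shows "GDERIV (\<lambda>y. y \<bullet> (A *v y)) x :> 2 *\<^sub>R (A *v x)"
proof -
  have "x \<bullet> (A *v h) = h \<bullet> (A *v x)" for h
    by (metis assms dot_lmul_matrix inner_commute transpose_matrix_vector)
  then have "(\<lambda>h. x \<bullet> (A *v h) + h \<bullet> (A *v x)) = (\<lambda>h. h \<bullet> (2 *\<^sub>R (A *v x)))"
    by (simp add: fun_eq_iff)
  moreover have "((\<lambda>y. y \<bullet> (A *v y)) has_derivative (\<lambda>h. x \<bullet> (A *v h) + h \<bullet> (A *v x))) (at x)"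
    by (auto intro!: derivative_eq_intros has_derivative_inner
        bounded_linear.has_derivative[OF matrix_vector_mul_bounded_linear])
  ultimately show ?thesis
    by (simp add: gderiv_def)
qed

section \<open>Coordinate vectors and inertia tensors\<close>

lemma vec3_eq_iff: "vec3 a b c = vec3 a' b' c' \<longleftrightarrow> a = a' \<and> b = b' \<and> c = c'"
  by (auto simp: vec_eq_iff forall_3)

lemma vec3_add: "vec3 a b c + vec3 a' b' c' = vec3 (a + a') (b + b') (c + c')"
  by (simp add: vec_eq_iff forall_3)

lemma vec3_diff: "vec3 a b c - vec3 a' b' c' = vec3 (a - a') (b - b') (c - c')"
  by (simp add: vec_eq_iff forall_3)

lemma vec3_scaleR: "s *\<^sub>R vec3 a b c = vec3 (s * a) (s * b) (s * c)"
  by (simp add: vec_eq_iff forall_3)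

lemma vec3_zero: "(0 :: real^3) = vec3 0 0 0"
  by (simp add: vec_eq_iff forall_3)

lemma vec3_cross: "vec3 a b c \<times> vec3 a' b' c' = vec3 (b * c' - c * b') (c * a' - a * c') (a * b' - b * a')"
  by (simp add: cross3_def)

lemma vec3_inner: "vec3 a b c \<bullet> vec3 a' b' c' = a * a' + b * b' + c * c'"
  by (simp add: inner_vec_def sum_3)

lemma norm_vec3_axis: "norm (vec3 a 0 0) = \<bar>a\<bar>"
  by (simp add: norm_eq_sqrt_inner vec3_inner)

lemmas vec3_simps = vec3_eq_iff vec3_add vec3_diff vec3_scaleR vec3_zero vec3_cross

lemma inertia_mult_vec3:
  "inertia P i *v vec3 a b c = vec3 (inA P i * a) (inA P i * b) (inC P i * c)"
  by (simp add: inertia_def vec_eq_iff forall_3 matrix_vector_mult_def sum_3)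

lemma transpose_inertia: "transpose (inertia P i) = inertia P i"
  by (simp add: inertia_def vec_eq_iff forall_3 transpose_def)

lemma invertible_inertia:
  assumes "inA P i > 0" "inC P i > 0"
  shows "invertible (inertia P i)"
  using assms by (simp add: invertible_det_nz det_3 inertia_def)

text \<open>Angular velocities are obtained from momenta through the inverse inertia tensor; this
  equivalence replaces the inverse by the tensor itself, so that no inverse has to be computed.\<close>

lemma matrix_inv_mult_vector_eq_iff:
  fixes A :: "real^'n^'n"
  assumes "invertible A"
  shows "matrix_inv A *v y = x \<longleftrightarrow> y = A *v x"
proof -
  have "A ** matrix_inv A = mat 1 \<and> matrix_inv A ** A = mat 1"
    using assms unfolding invertible_def matrix_inv_def by (rule someI_ex)
  then show ?thesis
    by (metis matrix_vector_mul_assoc matrix_vector_mul_lid)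
qed

section \<open>Forces derived from the potential\<close>

text \<open>The potential energy of the gyrostat, seen as a point mass, in the approximate field of body
  \<open>i\<close>: the Newtonian term together with MacCullagh's second-order term.\<close>

definition body_potential :: "gyro_params \<Rightarrow> nat \<Rightarrow> real^3 \<Rightarrow> real" where
  "body_potential P i x = - (grav P * mass P i * mass P 0 / norm x) - 1 / 2 * V2_summand P i x"

lemma V_eq:
  "V P l m = - (grav P * mass P 1 * mass P 2 / norm l)
     + body_potential P 1 (x1 P l m) + body_potential P 2 (x2 P l m)"
  by (simp add: V_def V1_def V2_def body_potential_def algebra_simps)

text \<open>For \<open>x\<close> in the equatorial plane the gradient \<open>2 A\<^sub>i x\<close> of \<open>x \<bullet> \<bbbI>\<^sub>i x\<close> is radial, like those of the
  powers of the norm. The terms of second order contribute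
  \<open>- G m\<^sub>0 / 2 * (- 3 (2 A\<^sub>i + C\<^sub>i) - 6 A\<^sub>i + 15 A\<^sub>i) = G m\<^sub>0 \<beta>\<^sub>i\<close> to the coefficient of \<open>x / |x|\<^sup>5\<close>.\<close>

lemma GDERIV_body_potential_equatorial:
  assumes "x \<noteq> 0" and eq: "inertia P i *v x = inA P i *\<^sub>R x"
  shows "GDERIV (body_potential P i) x
           :> (grav P * mass P 0 * (mass P i / norm x ^ 3 + beta P i / norm x ^ 5)) *\<^sub>R x"
proof -
  let ?k = "grav P * mass P 0" and ?q = "\<lambda>y. y \<bullet> (inertia P i *v y)"
  have pot: "body_potential P i = (\<lambda>y. (- ?k * mass P i) * (1 / norm y ^ 1)
      + ((- ?k * (2 * inA P i + inC P i) / 2) * (1 / norm y ^ 3)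
         + (3 * ?k / 2) * (?q y * (1 / norm y ^ 5))))"
    by (simp add: body_potential_def V2_summand_def fun_eq_iff algebra_simps add_divide_distrib diff_divide_distrib)
  have xx: "x \<bullet> x = norm x ^ 2"
    by (simp add: power2_norm_eq_inner)
  \<comment> \<open>The factor multiplying \<open>x\<close> in the gradient, as a function of \<open>n = norm x\<close>, as the product
    rule produces it.\<close>
  let ?c = "\<lambda>n. (- ?k * mass P i) * - (of_nat 1 / n ^ (1 + 2))
      + ((- ?k * (2 * inA P i + inC P i) / 2) * - (of_nat 3 / n ^ (3 + 2))
         + (3 * ?k / 2) * ((inA P i * n ^ 2) * - (of_nat 5 / n ^ (5 + 2)) + (1 / n ^ 5) * (2 * inA P i)))"
  have coeff: "?c n = ?k * (mass P i / n ^ 3 + beta P i / n ^ 5)" if "n > 0" for n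
    using that by (simp add: beta_def field_simps power_numeral_reduce)
  have "GDERIV (body_potential P i) x
      :> (- ?k * mass P i) *\<^sub>R (- (of_nat 1 / norm x ^ (1 + 2)) *\<^sub>R x)
      + ((- ?k * (2 * inA P i + inC P i) / 2) *\<^sub>R (- (of_nat 3 / norm x ^ (3 + 2)) *\<^sub>R x)
         + (3 * ?k / 2) *\<^sub>R (?q x *\<^sub>R (- (of_nat 5 / norm x ^ (5 + 2)) *\<^sub>R x)
                            + (1 / norm x ^ 5) *\<^sub>R (2 *\<^sub>R (inertia P i *v x))))" (is "GDERIV _ _ :> ?D")
    unfolding pot
    using GDERIV_add[OF GDERIV_mult[OF GDERIV_const GDERIV_inverse_norm_power[OF assms(1)]]
        GDERIV_add[OF GDERIV_mult[OF GDERIV_const GDERIV_inverse_norm_power[OF assms(1)]]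
        GDERIV_mult[OF GDERIV_const GDERIV_mult[OF GDERIV_quadratic_form[OF transpose_inertia]
           GDERIV_inverse_norm_power[OF assms(1)]]]],
        of "- ?k * mass P i" 1 "- ?k * (2 * inA P i + inC P i) / 2" 3 "3 * ?k / 2" P i 5]
    by simp
  also have "?D = ?c (norm x) *\<^sub>R x"
    by (simp only: eq xx inner_scaleR_right scaleR_scaleR scaleR_right_distrib scaleR_left_distrib
        distrib_left mult.assoc)
  also have "?c (norm x) = ?k * (mass P i / norm x ^ 3 + beta P i / norm x ^ 5)"
    using assms(1) by (intro coeff) simp
  finally show ?thesis .
qed

text \<open>In these Jacobi coordinates a change of \<open>\<lambda>\<close> at fixed \<open>\<mu>\<close> displaces the two bodies in opposite
  directions, in inverse proportion to their masses, which produces the weights \<open>- m\<^sub>2 / M\<^sub>2\<close> and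
  \<open>m\<^sub>1 / M\<^sub>2\<close>; a change of \<open>\<mu>\<close> displaces both bodies equally.\<close>

lemma GDERIV_potential_equatorial:
  assumes "l \<noteq> 0" "x1 P l m \<noteq> 0" "x2 P l m \<noteq> 0"
    and "inertia P 1 *v x1 P l m = inA P 1 *\<^sub>R x1 P l m"
    and "inertia P 2 *v x2 P l m = inA P 2 *\<^sub>R x2 P l m"
  defines "F \<equiv> \<lambda>i x. (grav P * mass P 0 * (mass P i / norm x ^ 3 + beta P i / norm x ^ 5)) *\<^sub>R x"
  shows "GDERIV (\<lambda>y. V P y m) l :> (grav P * mass P 1 * mass P 2 / norm l ^ 3) *\<^sub>R l
           - (mass P 2 / M2 P) *\<^sub>R F 1 (x1 P l m) + (mass P 1 / M2 P) *\<^sub>R F 2 (x2 P l m)" (is ?lam)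
    and "GDERIV (\<lambda>y. V P l y) m :> F 1 (x1 P l m) + F 2 (x2 P l m)" (is ?mu)
proof -
  have F1: "GDERIV (body_potential P 1) (x1 P l m) :> F 1 (x1 P l m)"
    and F2: "GDERIV (body_potential P 2) (x2 P l m) :> F 2 (x2 P l m)"
    unfolding F_def using assms by (auto intro!: GDERIV_body_potential_equatorial)
  have "GDERIV (\<lambda>y. body_potential P 1 ((- mass P 2 / M2 P) *\<^sub>R y + m)) l
          :> (- mass P 2 / M2 P) *\<^sub>R F 1 (x1 P l m)"
    by (rule GDERIV_compose_affine) (use F1 in \<open>simp add: x1_def\<close>)
  moreover have "GDERIV (\<lambda>y. body_potential P 2 ((mass P 1 / M2 P) *\<^sub>R y + m)) l
          :> (mass P 1 / M2 P) *\<^sub>R F 2 (x2 P l m)"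
    by (rule GDERIV_compose_affine) (use F2 in \<open>simp add: x2_def add.commute\<close>)
  moreover have "GDERIV (\<lambda>y. - (grav P * mass P 1 * mass P 2) * (1 / norm y ^ 1)) l
          :> (grav P * mass P 1 * mass P 2 / norm l ^ 3) *\<^sub>R l"
    using GDERIV_mult[OF GDERIV_const GDERIV_inverse_norm_power[OF assms(1)],
        of "- (grav P * mass P 1 * mass P 2)" 1] by (simp add: numeral_eq_Suc)
  ultimately show ?lam
    using GDERIV_add[OF GDERIV_add] by (fastforce simp: V_eq x1_def x2_def add.commute)
  have "GDERIV (\<lambda>y. body_potential P 1 (1 *\<^sub>R y + (- (mass P 2 / M2 P) *\<^sub>R l))) m
          :> 1 *\<^sub>R F 1 (x1 P l m)"
    by (rule GDERIV_compose_affine) (use F1 in \<open>simp add: x1_def\<close>)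
  moreover have "GDERIV (\<lambda>y. body_potential P 2 (1 *\<^sub>R y + (mass P 1 / M2 P) *\<^sub>R l)) m
          :> 1 *\<^sub>R F 2 (x2 P l m)"
    by (rule GDERIV_compose_affine) (use F2 in \<open>simp add: x2_def\<close>)
  ultimately show ?mu
    using GDERIV_add[OF GDERIV_add[OF GDERIV_const], of _ m _ _ _ "- (grav P * mass P 1 * mass P 2 / norm l)"]
    unfolding V_eq by (fastforce simp: x1_def x2_def add.commute)
qed

text \<open>A central attraction, restricted to a line, in the units of \<open>h1\<close> and \<open>h2\<close>: of the odd powers of
  \<open>|s|\<close> one factor cancels against \<open>s\<close> and leaves its sign, so that only even powers of \<open>s\<close>
  remain.\<close>

lemma axis_attraction:
  fixes s t a b :: real
  assumes "s \<noteq> 0" "t \<noteq> 0"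
  shows "(a / \<bar>s * t\<bar> ^ 3 + b / \<bar>s * t\<bar> ^ 5) * (s * t)
         = sgn_pm s / \<bar>t\<bar> ^ 3 * (a / s\<^sup>2 + b / (s ^ 4 * t\<^sup>2)) * t"
proof -
  define u v where "u = \<bar>s\<bar>" and "v = \<bar>t\<bar>"
  have uv: "u > 0" "v > 0" and s: "s = sgn_pm s * u"
    using assms by (auto simp: u_def v_def sgn_pm_def)
  have "(a / \<bar>s * t\<bar> ^ 3 + b / \<bar>s * t\<bar> ^ 5) * (s * t)
      = (a / (u * v) ^ 3 + b / (u * v) ^ 5) * (sgn_pm s * u) * t"
    by (simp only: abs_mult u_def[symmetric] v_def[symmetric] s[symmetric] mult.assoc)
  also have "(a / (u * v) ^ 3 + b / (u * v) ^ 5) * (sgn_pm s * u)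
      = sgn_pm s / v ^ 3 * (a / u\<^sup>2 + b / (u ^ 4 * v\<^sup>2))"
    using uv by (simp add: field_simps power_numeral_reduce)
  finally show ?thesis
    by (simp add: u_def v_def power_even_abs_numeral)
qed

section \<open>The collinear configuration\<close>

text \<open>The functions \<open>h1\<close> and \<open>h2\<close> are the ratios of the two partial gradients to \<open>\<lambda>\<close> when the three
  centres of mass are collinear. The body 1 sits at \<open>\<rho> \<lambda>\<close> and the body 2 at \<open>(1 + \<rho>) \<lambda>\<close>, which is
  why \<open>\<rho> = 0\<close> and \<open>\<rho> = -1\<close> are the collisions with the gyrostat.\<close>

lemma GDERIV_potential_axis:
  fixes lam_e mu_e \<rho> :: real
  assumes "M2 P \<noteq> 0" "lam_e \<noteq> 0" "\<rho> \<noteq> 0" "1 + \<rho> \<noteq> 0"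
    and mu: "mu_e = ((1 + \<rho>) * mass P 2 + \<rho> * mass P 1) / M2 P * lam_e"
  defines "l \<equiv> vec3 lam_e 0 0" and "m \<equiv> vec3 mu_e 0 0"
  shows "x1 P l m = vec3 (\<rho> * lam_e) 0 0"
    and "x2 P l m = vec3 ((1 + \<rho>) * lam_e) 0 0"
    and "GDERIV (\<lambda>y. V P y m) l :> vec3 (h1 P \<bar>lam_e\<bar> \<rho> * lam_e) 0 0"
    and "GDERIV (\<lambda>y. V P l y) m :> vec3 (h2 P \<bar>lam_e\<bar> \<rho> * lam_e) 0 0"
proof -
  have "mu_e - mass P 2 / M2 P * lam_e = \<rho> * lam_e"
    "mu_e + mass P 1 / M2 P * lam_e = (1 + \<rho>) * lam_e"
    using assms(1) unfolding mu by (simp_all add: field_simps) (simp_all add: M2_def algebra_simps)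
  then show x1: "x1 P l m = vec3 (\<rho> * lam_e) 0 0" and x2: "x2 P l m = vec3 ((1 + \<rho>) * lam_e) 0 0"
    by (simp_all add: x1_def x2_def l_def m_def vec3_simps)
  \<comment> \<open>\<open>k * T i s * lam_e\<close> is the slope of the potential of body \<open>i\<close> at the point \<open>s * lam_e\<close> of the
    axis; \<open>h1\<close> and \<open>h2\<close> depend affinely on \<open>k * T 1 \<rho>\<close> and \<open>k * T 2 (1 + \<rho>)\<close>.\<close>
  define k where "k = grav P * mass P 0"
  define T where "T = (\<lambda>i s. sgn_pm s / \<bar>lam_e\<bar> ^ 3
      * (mass P i / s\<^sup>2 + beta P i / (s ^ 4 * lam_e\<^sup>2)))"
  have T: "(k * (mass P i / norm (vec3 (s * lam_e) 0 0) ^ 3 + beta P i / norm (vec3 (s * lam_e) 0 0) ^ 5))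
      *\<^sub>R vec3 (s * lam_e) 0 0 = vec3 (k * T i s * lam_e) 0 0" if "s \<noteq> 0" for i s
    using axis_attraction[OF that assms(2), of "mass P i" "beta P i"]
    by (simp add: T_def norm_vec3_axis vec3_scaleR mult.assoc)
  have h1: "h1 P \<bar>lam_e\<bar> \<rho> = grav P * mass P 1 * mass P 2 / \<bar>lam_e\<bar> ^ 3
      - mass P 2 / M2 P * (k * T 1 \<rho>) + mass P 1 / M2 P * (k * T 2 (1 + \<rho>))"
    unfolding h1_def T_def k_def by (simp add: mult_ac)
  have h2: "h2 P \<bar>lam_e\<bar> \<rho> = k * T 1 \<rho> + k * T 2 (1 + \<rho>)"
    unfolding h2_def T_def k_def by (simp add: mult_ac)
  have nz: "l \<noteq> 0" "x1 P l m \<noteq> 0" "x2 P l m \<noteq> 0"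
    unfolding x1 x2 unfolding l_def using assms(2-4) by (simp_all add: vec3_simps)
  have eq: "inertia P 1 *v x1 P l m = inA P 1 *\<^sub>R x1 P l m"
    "inertia P 2 *v x2 P l m = inA P 2 *\<^sub>R x2 P l m"
    unfolding x1 x2 by (simp_all add: inertia_mult_vec3 vec3_simps)
  note D = GDERIV_potential_equatorial[OF nz eq, folded k_def, unfolded x1 x2 T[OF assms(3)] T[OF assms(4)]]
  show "GDERIV (\<lambda>y. V P y m) l :> vec3 (h1 P \<bar>lam_e\<bar> \<rho> * lam_e) 0 0"
    using D(1) unfolding h1 l_def by (simp add: norm_vec3_axis vec3_simps algebra_simps)
  show "GDERIV (\<lambda>y. V P l y) m :> vec3 (h2 P \<bar>lam_e\<bar> \<rho> * lam_e) 0 0"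
    using D(2) unfolding h2 by (simp add: vec3_simps algebra_simps)
qed

theorem proposition9:
  fixes P :: gyro_params and z :: gyro_state
    and \<rho> lam_e mu_e \<omega>\<^sub>0 :: real
  assumes "admissible P"
    and "\<bar>lam_e\<bar> > 0"
    and "\<rho> \<noteq> 0" and "1 + \<rho> \<noteq> 0"
    and "mass P 0 * (mass P 1 + mass P 2) * ((1 + \<rho>) * mass P 2 + \<rho> * mass P 1) * h1 P \<bar>lam_e\<bar> \<rho>
         = mass P 1 * mass P 2 * (mass P 0 + mass P 1 + mass P 2) * h2 P \<bar>lam_e\<bar> \<rho>"
    and "mu_e = ((1 + \<rho>) * mass P 2 + \<rho> * mass P 1) / M2 P * lam_e"
    and "\<omega>\<^sub>0\<^sup>2 = (mass P 1 + mass P 2) * h1 P \<bar>lam_e\<bar> \<rho> / (mass P 1 * mass P 2)"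
    and "lam z = vec3 lam_e 0 0"
    and "mu z = vec3 mu_e 0 0"
    and "plam z = vec3 0 (g1 P * \<omega>\<^sub>0 * lam_e) 0"
    and "pmu z = vec3 0 (g2 P * \<omega>\<^sub>0 * mu_e) 0"
    and "Pi0 z = vec3 0 0 (inC P 0 * \<omega>\<^sub>0 + gyro_l P)"
    and "Pi1 z \<times> Omega1 P z = 0"
    and "Pi2 z \<times> Omega2 P z = 0"
  shows "Omega0 P z = vec3 0 0 \<omega>\<^sub>0
    \<and> eulerian_relative_equilibrium P z
    \<and> (\<forall>\<omega>\<^sub>1 \<omega>\<^sub>2. Omega1 P z = vec3 0 0 \<omega>\<^sub>1 \<and> Omega2 P z = vec3 0 0 \<omega>\<^sub>2 \<longrightarrow>
          total_angular_momentum z =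
            vec3 0 0 (inC P 2 * \<omega>\<^sub>2 + inC P 1 * \<omega>\<^sub>1 + inC P 0 * \<omega>\<^sub>0 + gyro_l P
                      + g1 P * \<omega>\<^sub>0 * lam_e\<^sup>2 + g2 P * \<omega>\<^sub>0 * mu_e\<^sup>2))"
proof -
  have pos: "mass P 0 > 0" "mass P 1 > 0" "mass P 2 > 0"
    and inert: "invertible (inertia P 0)" "invertible (inertia P 1)" "invertible (inertia P 2)"
    using assms(1) by (auto simp: admissible_def intro!: invertible_inertia)
  then have M_pos: "M2 P > 0" "M1 P > 0" and g_pos: "g1 P > 0" "g2 P > 0"
    by (simp_all add: M2_def M1_def g1_def g2_def)
  let ?h1 = "h1 P \<bar>lam_e\<bar> \<rho>" and ?h2 = "h2 P \<bar>lam_e\<bar> \<rho>"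
  have lam_nz: "lam_e \<noteq> 0"
    using assms(2) by simp
  have "M2 P \<noteq> 0"
    using M_pos by simp
  note grad = GDERIV_potential_axis[OF this lam_nz assms(3,4,6)]

  have Omega0: "Omega0 P z = vec3 0 0 \<omega>\<^sub>0"
    unfolding Omega0_def assms(12) matrix_inv_mult_vector_eq_iff[OF inert(1)]
    by (simp add: inertia_mult_vec3 vec3_simps)

  \<comment> \<open>Centrifugal force against gravity, in the directions of \<open>\<lambda>\<close> and of \<open>\<mu>\<close>.\<close>
  have balance_lam: "g1 P * \<omega>\<^sub>0\<^sup>2 = ?h1"
    unfolding assms(7) g1_def M2_def[symmetric] using pos M_pos by simp
  have balance_mu: "g2 P * \<omega>\<^sub>0\<^sup>2 * mu_e = ?h2 * lam_e"
  proof -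
    let ?c = "(1 + \<rho>) * mass P 2 + \<rho> * mass P 1"
    have "g2 P * \<omega>\<^sub>0\<^sup>2 * mu_e = mass P 0 * M2 P * ?c * ?h1 / (mass P 1 * mass P 2 * M1 P) * lam_e"
      unfolding assms(6,7) g2_def M2_def[symmetric] using M_pos pos by (simp add: mult_ac)
    also have "mass P 0 * M2 P * ?c * ?h1 = mass P 1 * mass P 2 * M1 P * ?h2"
      using assms(5) by (simp add: M2_def M1_def)
    finally show ?thesis
      using M_pos pos by simp
  qed

  have "relative_equilibrium P z"
    unfolding relative_equilibrium_def assms(8-12) Omega0 grad(1,2)
  proof (intro conjI exI)
    show "GDERIV (\<lambda>y. V P y (vec3 mu_e 0 0)) (vec3 lam_e 0 0) :> vec3 (?h1 * lam_e) 0 0"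
      "GDERIV (\<lambda>y. V P (vec3 lam_e 0 0) y) (vec3 mu_e 0 0) :> vec3 (?h2 * lam_e) 0 0"
      by (rule grad)+
    show "vec3 0 (g1 P * \<omega>\<^sub>0 * lam_e) 0 \<times> vec3 0 0 \<omega>\<^sub>0 = vec3 (?h1 * lam_e) 0 0"
      unfolding balance_lam[symmetric] by (simp add: vec3_simps power2_eq_square)
    show "vec3 0 (g2 P * \<omega>\<^sub>0 * mu_e) 0 \<times> vec3 0 0 \<omega>\<^sub>0 = vec3 (?h2 * lam_e) 0 0"
      unfolding balance_mu[symmetric] by (simp add: vec3_simps power2_eq_square)
  qed (use lam_nz assms(3,4,13,14) g_pos in \<open>simp_all add: vec3_simps\<close>)
  moreover have "mu z = (mu_e / lam_e) *\<^sub>R lam z"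
    using lam_nz by (simp add: assms(8,9) vec3_simps)
  moreover have "orthogonal (Omega0 P z) v" if "v \<in> span {lam z, mu z}" for v
    using that by (rule orthogonal_to_span)
      (auto simp: Omega0 assms(8,9) orthogonal_def vec3_inner)
  ultimately have "eulerian_relative_equilibrium P z"
    unfolding eulerian_relative_equilibrium_def by blast

  moreover have "total_angular_momentum z =
      vec3 0 0 (inC P 2 * \<omega>\<^sub>2 + inC P 1 * \<omega>\<^sub>1 + inC P 0 * \<omega>\<^sub>0 + gyro_l P
                + g1 P * \<omega>\<^sub>0 * lam_e\<^sup>2 + g2 P * \<omega>\<^sub>0 * mu_e\<^sup>2)"
    if "Omega1 P z = vec3 0 0 \<omega>\<^sub>1" "Omega2 P z = vec3 0 0 \<omega>\<^sub>2" for \<omega>\<^sub>1 \<omega>\<^sub>2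
  proof -
    have "Pi1 z = vec3 0 0 (inC P 1 * \<omega>\<^sub>1)" "Pi2 z = vec3 0 0 (inC P 2 * \<omega>\<^sub>2)"
      using that
      unfolding Omega1_def Omega2_def matrix_inv_mult_vector_eq_iff[OF inert(2)]
        matrix_inv_mult_vector_eq_iff[OF inert(3)]
      by (simp_all add: inertia_mult_vec3)
    then show ?thesis
      by (simp add: total_angular_momentum_def assms(8-12) vec3_simps power2_eq_square algebra_simps)
  qed
  ultimately show ?thesis
    using Omega0 by blast
qed

end
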